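(* Let $K$ be a compact subset of a Banach space $X$, let $f:X\to X$ be continuously differentiable in a neighbourhood of $K$, and let $K$ be negatively invariant for $f$, i.e. $f(K)\supseteq K$. Suppose that there exist $\alpha$ with $0<\alpha<1$ and $M\ge 1$ such that for every $x\in K$, $$N_X(Df(x)[B_X(0,1)],\alpha)\le M.$$ Then $$\dim_B(K)\le \frac{\log M}{-\log\alpha}.$$
   Context: $B_X(x,r)$ denotes the ball in $X$ of radius $r$ centred at $x$, and $Df(x)$ is the (Fréchet) derivative of $f$ at $x$. For a subset $S$ of $X$ and $\epsilon>0$, $N_X(S,\epsilon)$ denotes the minimum number of balls in $X$ of radius $\epsilon$ needed to cover $S$. The upper box-counting dimension of a compact set $K\subset X$ is $$\dim_B(K)=\limsup_{\epsilon\to 0}\frac{\log N_X(K,\epsilon)}{-\log\epsilon}.$$ *)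

theory Defs
  imports "HOL-Analysis.Analysis"
begin

text \<open>Minimum number of open balls of radius \<open>\<epsilon>\<close>, with centres anywhere in the ambient space,
  needed to cover \<open>S\<close>. The infimum of the empty set is \<open>\<infinity>\<close>, so the value is \<open>\<infinity>\<close> exactly if
  there is no finite cover.\<close>

definition covering_number :: "'a::metric_space set \<Rightarrow> real \<Rightarrow> enat" where
  "covering_number S \<epsilon> =
     (INF C \<in> {C. finite C \<and> S \<subseteq> (\<Union>c\<in>C. ball c \<epsilon>)}. enat (card C))"

text \<open>Logarithm of an extended natural number, with \<open>log 0 = -\<infinity>\<close> and \<open>log \<infinity> = \<infinity>\<close>
  (in contrast to \<open>ln 0 = 0\<close> for the library's real logarithm).\<close>

definition ln_enat :: "enat \<Rightarrow> ereal" where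
  "ln_enat n = (case n of enat k \<Rightarrow> if k = 0 then -\<infinity> else ereal (ln (real k)) | \<infinity> \<Rightarrow> \<infinity>)"

definition upper_box_dim :: "'a::metric_space set \<Rightarrow> ereal" where
  "upper_box_dim K =
     Limsup (at_right 0) (\<lambda>\<epsilon>. ln_enat (covering_number K \<epsilon>) / ereal (- ln \<epsilon>))"

end

theory Submission
  imports Defs "HOL-Real_Asymp.Real_Asymp"
begin

text \<open>Fix \<open>\<beta> = \<alpha> + \<eta>\<close> with \<open>\<alpha> < \<beta> < 1\<close>. By compactness, on all sufficiently small balls meeting \<open>K\<close> the
  map \<open>f\<close> is, up to an error \<open>\<eta>\<close> times the distance, affine with linear part \<open>Df(x)\<close>, where \<open>x\<close> is any
  point of \<open>K\<close> in the ball. So the image of a ball of radius \<open>r\<close> meeting \<open>K\<close> is covered by \<open>M\<close> balls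
  of radius \<open>\<beta> r\<close>. The linear part is taken at \<open>x\<close> and not at the centre, which need not lie in \<open>K\<close>;
  recentring the balls at points of \<open>K\<close> would instead lose a factor \<open>2\<close> at every step.
  Since \<open>K \<subseteq> f(K)\<close>, iteration gives \<open>N(K, \<beta>\<^sup>n r) \<le> M\<^sup>n N(K, r)\<close>, hence the dimension is at most
  \<open>log M / (- log \<beta>)\<close>, and \<open>\<beta>\<close> may tend to \<open>\<alpha>\<close>.\<close>

text \<open>Extended naturals are well-ordered, so the infimum over a nonempty family is attained,
  and a finite bound excludes the empty family, whose infimum is \<infinity>. Later proofs can thus
  pass between bounds and actual covers.\<close>

lemma covering_number_le_iff:
  "ereal_of_enat (covering_number S \<epsilon>) \<le> ereal B \<longleftrightarrow>
     (\<exists>C. finite C \<and> S \<subseteq> (\<Union>c\<in>C. ball c \<epsilon>) \<and> real (card C) \<le> B)"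
proof
  let ?A = "(\<lambda>C. enat (card C)) ` {C. finite C \<and> S \<subseteq> (\<Union>c\<in>C. ball c \<epsilon>)}"
  assume L: "ereal_of_enat (covering_number S \<epsilon>) \<le> ereal B"
  then have "covering_number S \<epsilon> \<noteq> \<infinity>"
    by (cases "covering_number S \<epsilon>") auto
  then have "?A \<noteq> {}"
    unfolding covering_number_def by (metis Inf_empty top_enat_def)
  then have "Inf ?A \<in> ?A"
    unfolding Inf_enat_def by (metis (mono_tags, lifting) LeastI_ex ex_in_conv)
  then obtain C where "finite C" "S \<subseteq> (\<Union>c\<in>C. ball c \<epsilon>)" "covering_number S \<epsilon> = enat (card C)"
    unfolding covering_number_def by auto
  with L show "\<exists>C. finite C \<and> S \<subseteq> (\<Union>c\<in>C. ball c \<epsilon>) \<and> real (card C) \<le> B"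
    by auto
next
  assume "\<exists>C. finite C \<and> S \<subseteq> (\<Union>c\<in>C. ball c \<epsilon>) \<and> real (card C) \<le> B"
  then obtain C where C: "finite C" "S \<subseteq> (\<Union>c\<in>C. ball c \<epsilon>)" "real (card C) \<le> B"
    by blast
  then have "covering_number S \<epsilon> \<le> enat (card C)"
    unfolding covering_number_def by (intro INF_lower) auto
  then have "ereal_of_enat (covering_number S \<epsilon>) \<le> ereal_of_enat (enat (card C))"
    by (simp only: ereal_of_enat_le_iff)
  also have "\<dots> \<le> ereal B"
    using C by simp
  finally show "ereal_of_enat (covering_number S \<epsilon>) \<le> ereal B" .
qed

lemma covering_number_antimono:
  assumes "\<delta> \<le> \<epsilon>"
  shows "covering_number S \<epsilon> \<le> covering_number S \<delta>"
  unfolding covering_number_def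
  by (rule INF_superset_mono) (use assms subset_ball in blast)+

lemma ln_enat_le:
  assumes "ereal_of_enat n \<le> ereal B" "1 \<le> B"
  shows "ln_enat n \<le> ereal (ln B)"
  using assms by (cases n) (auto simp: ln_enat_def)

lemma compact_imp_covering_number_finite:
  assumes "compact K" "0 < \<epsilon>"
  obtains B where "1 \<le> B" "ereal_of_enat (covering_number K \<epsilon>) \<le> ereal B"
proof -
  obtain C where "finite C" "K \<subseteq> (\<Union>c\<in>C. ball c \<epsilon>)"
    using compact_imp_seq_compact[OF assms(1), THEN seq_compact_imp_totally_bounded] assms(2) by blast
  \<comment> \<open>The maximum covers the case of an empty \<open>C\<close>;
    \<open>1 \<le> B\<close> later keeps the bounds \<open>M ^ n * B\<close> at least 1, as
    \<open>ln_enat_le\<close> requires.\<close>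
  then have "ereal_of_enat (covering_number K \<epsilon>) \<le> ereal (max 1 (real (card C)))"
    unfolding covering_number_le_iff by force
  then show thesis
    using that max.cobounded1 by blast
qed

text \<open>Uniform continuity on \<open>K\<close> would not do, since \<open>z\<close> may lie
  outside \<open>K\<close>, and \<open>K\<close> need not have a compact neighbourhood. Instead
  \<delta> is a Lebesgue number of a cover of \<open>K\<close> by open sets on which
  \<open>g\<close> varies by less than \<eta>.\<close>

lemma compact_uniform_nhd_continuous:
  fixes g :: "'a::metric_space \<Rightarrow> 'b::metric_space"
  assumes "compact K" "open U" "K \<subseteq> U" "continuous_on U g" "0 < \<eta>"
  obtains \<delta> where "0 < \<delta>" "\<And>x z. x \<in> K \<Longrightarrow> dist x z < \<delta> \<Longrightarrow> z \<in> U \<and> dist (g z) (g x) < \<eta>"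
proof -
  define V where "V y = U \<inter> g -` ball (g y) (\<eta> / 2)" for y
  have V: "open (V y)" for y
    unfolding V_def using assms(2,4) by (auto intro: continuous_open_preimage)
  have cov: "K \<subseteq> \<Union> (V ` K)"
    using assms(3,5) by (auto simp: V_def)
  obtain \<delta> where d: "0 < \<delta>" "\<And>x. x \<in> K \<Longrightarrow> \<exists>G\<in>V ` K. ball x \<delta> \<subseteq> G"
    by (rule Heine_Borel_lemma[OF assms(1) cov]) (use V in blast)+
  have "z \<in> U \<and> dist (g z) (g x) < \<eta>" if x: "x \<in> K" and xz: "dist x z < \<delta>" for x z
  proof -
    obtain y where y: "ball x \<delta> \<subseteq> V y"
      using d(2)[OF x] by blast
    have "z \<in> V y" "x \<in> V y"
      using y xz d(1) by auto
    then have "z \<in> U" "dist (g y) (g z) < \<eta> / 2" "dist (g y) (g x) < \<eta> / 2"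
      by (auto simp: V_def)
    then show ?thesis
      by (metis dist_commute dist_triangle_half_r)
  qed
  with d(1) show thesis
    using that by blast
qed

text \<open>This is the mean value inequality for \<open>f - f' x\<close> on the convex ball around
  \<open>x\<close>, where the derivative \<open>f' w - f' x\<close> has norm below \<eta>. Both
  \<open>y\<close> and \<open>z\<close> are free, so that \<open>z\<close> can later be a ball
  centre outside \<open>K\<close>.\<close>

lemma compact_uniform_linear_approx:
  fixes f :: "'a::real_normed_vector \<Rightarrow> 'b::real_normed_vector" and f' :: "'a \<Rightarrow> 'a \<Rightarrow>\<^sub>L 'b"
  assumes "compact K" "open U" "K \<subseteq> U" "continuous_on U f'" "0 < \<eta>"
    and deriv: "\<And>x. x \<in> U \<Longrightarrow> (f has_derivative blinfun_apply (f' x)) (at x)"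
  obtains \<delta> where "0 < \<delta>"
    "\<And>x y z. \<lbrakk>x \<in> K; y \<in> ball x \<delta>; z \<in> ball x \<delta>\<rbrakk> \<Longrightarrow>
       norm (f y - f z - f' x (y - z)) \<le> \<eta> * norm (y - z)"
proof -
  obtain \<delta> where d: "0 < \<delta>"
    "\<And>x z. x \<in> K \<Longrightarrow> dist x z < \<delta> \<Longrightarrow> z \<in> U \<and> dist (f' z) (f' x) < \<eta>"
    using compact_uniform_nhd_continuous[OF assms(1-5)] by blast
  have "norm (f y - f z - f' x (y - z)) \<le> \<eta> * norm (y - z)"
    if x: "x \<in> K" and y: "y \<in> ball x \<delta>" and z: "z \<in> ball x \<delta>" for x y z
  proof -
    have "norm ((f y - f' x y) - (f z - f' x z)) \<le> \<eta> * norm (y - z)"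
    proof (rule differentiable_bound[OF convex_ball _ _ y z])
      fix w assume w: "w \<in> ball x \<delta>"
      then have wU: "w \<in> U" "dist (f' w) (f' x) < \<eta>"
        using d(2)[OF x] by auto
      show "((\<lambda>v. f v - f' x v) has_derivative blinfun_apply (f' w - f' x)) (at w within ball x \<delta>)"
        unfolding minus_blinfun.rep_eq
        by (intro has_derivative_diff has_derivative_at_withinI[OF deriv[OF wU(1)]]
            bounded_linear_imp_has_derivative blinfun.bounded_linear_right)
      show "onorm (blinfun_apply (f' w - f' x)) \<le> \<eta>"
        using wU(2) by (simp add: dist_norm norm_blinfun.rep_eq)
    qed
    then show ?thesis
      by (simp add: blinfun.diff_right algebra_simps)
  qed
  with d(1) show thesis
    using that by blast
qed

lemma covering_number_image_ball:
  fixes f :: "'a::real_normed_vector \<Rightarrow> 'b::real_normed_vector" and A :: "'a \<Rightarrow>\<^sub>L 'b"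
  assumes "0 < r"
    and approx: "\<And>y. y \<in> ball c r \<Longrightarrow> norm (f y - f c - A (y - c)) \<le> \<eta> * r"
    and cov: "ereal_of_enat (covering_number (A ` ball 0 1) \<alpha>) \<le> ereal M"
  shows "ereal_of_enat (covering_number (f ` ball c r) ((\<alpha> + \<eta>) * r)) \<le> ereal M"
proof -
  obtain E where E: "finite E" "A ` ball 0 1 \<subseteq> (\<Union>e\<in>E. ball e \<alpha>)" "real (card E) \<le> M"
    using cov unfolding covering_number_le_iff by blast
  let ?C = "(\<lambda>e. f c + r *\<^sub>R e) ` E"
  have "f ` ball c r \<subseteq> (\<Union>e\<in>?C. ball e ((\<alpha> + \<eta>) * r))"
  proof safe
    fix y assume y: "y \<in> ball c r"
    let ?u = "(1 / r) *\<^sub>R (y - c)"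
    have "?u \<in> ball 0 1"
      using y assms(1) by (simp add: dist_norm norm_minus_commute)
    then obtain e where e: "e \<in> E" "norm (A ?u - e) < \<alpha>"
      using E(2) by (force simp: dist_norm norm_minus_commute)
    have "A (y - c) - r *\<^sub>R e = r *\<^sub>R (A ?u - e)"
      using assms(1) by (simp add: blinfun.scaleR_right blinfun.diff_right scaleR_diff_right)
    then have "norm (A (y - c) - r *\<^sub>R e) < \<alpha> * r"
      using e(2) assms(1) by (simp add: mult.commute)
    then have "norm ((f y - f c - A (y - c)) + (A (y - c) - r *\<^sub>R e)) < \<eta> * r + \<alpha> * r"
      using approx[OF y] by (intro norm_triangle_lt add_le_less_mono)
    then have "f y \<in> ball (f c + r *\<^sub>R e) ((\<alpha> + \<eta>) * r)"
      by (simp add: dist_norm norm_minus_commute algebra_simps)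
    with e(1) show "f y \<in> (\<Union>e\<in>?C. ball e ((\<alpha> + \<eta>) * r))"
      by blast
  qed
  moreover have "real (card ?C) \<le> M"
    using card_image_le[OF E(1), of "\<lambda>e. f c + r *\<^sub>R e"] E(3) by linarith
  ultimately show ?thesis
    unfolding covering_number_le_iff using E(1) by (intro exI[of _ ?C]) auto
qed

text \<open>Negative invariance enters here: each point of \<open>K\<close> is the image of a point
  of \<open>K\<close>, which lies in some ball of the cover, so the images of these balls cover
  \<open>K\<close> again.\<close>

lemma covering_number_step:
  fixes f :: "'a::metric_space \<Rightarrow> 'a"
  assumes "K \<subseteq> f ` K" "0 \<le> M"
    and ball: "\<And>c x. x \<in> K \<Longrightarrow> x \<in> ball c r \<Longrightarrow>
      ereal_of_enat (covering_number (f ` ball c r) s) \<le> ereal M"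
    and B: "ereal_of_enat (covering_number K r) \<le> ereal B"
  shows "ereal_of_enat (covering_number K s) \<le> ereal (M * B)"
proof -
  obtain C where C: "finite C" "K \<subseteq> (\<Union>c\<in>C. ball c r)" "real (card C) \<le> B"
    using B unfolding covering_number_le_iff by blast
  \<comment> \<open>Balls that miss \<open>K\<close> are discarded, because \<open>ball\<close>
    controls only images of balls containing a point of \<open>K\<close>.\<close>
  define C' where "C' = {c \<in> C. K \<inter> ball c r \<noteq> {}}"
  have C': "finite C'" "real (card C') \<le> B"
    using C card_mono[of C C'] by (auto simp: C'_def)
  have "\<forall>c\<in>C'. \<exists>E. finite E \<and> f ` ball c r \<subseteq> (\<Union>e\<in>E. ball e s) \<and> real (card E) \<le> M"
    using ball unfolding C'_def covering_number_le_iff by blast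
  then obtain E where E: "\<And>c. c \<in> C' \<Longrightarrow>
      finite (E c) \<and> f ` ball c r \<subseteq> (\<Union>e\<in>E c. ball e s) \<and> real (card (E c)) \<le> M"
    by metis
  have "K \<subseteq> (\<Union>e\<in>(\<Union>c\<in>C'. E c). ball e s)"
  proof
    fix y assume "y \<in> K"
    then obtain x where x: "x \<in> K" "y = f x"
      using assms(1) by blast
    then obtain c where "c \<in> C'" "x \<in> ball c r"
      using C(2) unfolding C'_def by blast
    then show "y \<in> (\<Union>e\<in>(\<Union>c\<in>C'. E c). ball e s)"
      using E[of c] x(2) by blast
  qed
  moreover have "finite (\<Union>c\<in>C'. E c)"
    using C' E by blast
  moreover have "real (card (\<Union>c\<in>C'. E c)) \<le> M * B"
  proof -
    have "real (card (\<Union>c\<in>C'. E c)) \<le> (\<Sum>c\<in>C'. real (card (E c)))"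
      using card_UN_le[OF C'(1), of E] by (simp flip: of_nat_sum)
    also have "\<dots> \<le> real (card C') * M"
      using E by (intro sum_bounded_above) auto
    also have "\<dots> \<le> M * B"
      using mult_left_mono[OF C'(2) assms(2)] by (simp add: mult.commute)
    finally show ?thesis .
  qed
  ultimately show ?thesis
    unfolding covering_number_le_iff by blast
qed

lemma upper_box_dim_le:
  assumes "0 < \<beta>" "\<beta> < 1" "1 \<le> M" "0 < r" "1 \<le> B"
    and cov: "\<And>n. ereal_of_enat (covering_number K (\<beta> ^ n * r)) \<le> ereal (M ^ n * B)"
  shows "upper_box_dim K \<le> ereal (ln M / (- ln \<beta>))"
proof -
  \<comment> \<open>This is \<open>((1 + t) * ln M + ln B) / (- ln \<epsilon>)\<close> for the
    exponent \<open>t\<close> defined below, sorted by powers of \<open>ln \<epsilon>\<close> so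
    that the limit can be read off.\<close>
  define g where "g \<epsilon> = (((1 - ln r / ln \<beta>) * ln M + ln B) + (ln M / ln \<beta>) * ln \<epsilon>) / (- ln \<epsilon>)" for \<epsilon>
  have ln\<beta>: "ln \<beta> < 0"
    using assms by simp
  \<comment> \<open>\<open>\<epsilon> < 1\<close> makes the divisor \<open>- ln \<epsilon>\<close>
    positive, and \<open>\<epsilon> < r\<close> makes \<open>t\<close> nonnegative.\<close>
  have bound: "ln_enat (covering_number K \<epsilon>) / ereal (- ln \<epsilon>) \<le> ereal (g \<epsilon>)"
    if e: "0 < \<epsilon>" "\<epsilon> < min 1 r" for \<epsilon>
  proof -
    \<comment> \<open>The real exponent at which \<beta> to the power \<open>t\<close>, times
      \<open>r\<close>, equals \<epsilon>. Rounding it up gives a scale at most \<epsilon> and costs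
      at most one extra factor \<open>M\<close>, which vanishes in the limit.\<close>
    define t where "t = (ln \<epsilon> - ln r) / ln \<beta>"
    have t: "0 \<le> t"
      unfolding t_def using e assms ln\<beta> by (intro divide_nonpos_neg) auto
    define n where "n = nat \<lceil>t\<rceil>"
    have n: "t \<le> real n" "real n \<le> 1 + t"
      unfolding n_def using t by linarith+
    have "real n * ln \<beta> \<le> t * ln \<beta>"
      using n(1) ln\<beta> by (simp add: mult_right_mono_neg)
    also have "\<dots> = ln \<epsilon> - ln r"
      using ln\<beta> by (simp add: t_def)
    finally have "ln (\<beta> ^ n * r) \<le> ln \<epsilon>"
      using assms by (simp add: ln_mult ln_realpow)
    then have "\<beta> ^ n * r \<le> \<epsilon>"
      using assms e by simp
    then have "ereal_of_enat (covering_number K \<epsilon>) \<le> ereal (M ^ n * B)"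
      using cov[of n] covering_number_antimono[of "\<beta> ^ n * r" \<epsilon> K]
      by (meson ereal_of_enat_le_iff order_trans)
    moreover have "1 \<le> M ^ n * B"
      using assms mult_mono[of 1 "M ^ n" 1 B] by simp
    ultimately have "ln_enat (covering_number K \<epsilon>) \<le> ereal (ln (M ^ n * B))"
      by (rule ln_enat_le)
    also have "ln (M ^ n * B) = real n * ln M + ln B"
      using assms by (simp add: ln_mult ln_realpow)
    also have "\<dots> \<le> (1 + t) * ln M + ln B"
      using n(2) assms by (simp add: mult_right_mono)
    also have "\<dots> = g \<epsilon> * (- ln \<epsilon>)"
      using e ln\<beta> by (simp add: g_def t_def field_simps)
    finally have "ln_enat (covering_number K \<epsilon>) \<le> ereal (- ln \<epsilon>) * ereal (g \<epsilon>)"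
      by (simp add: mult.commute)
    then show ?thesis
      using e by (subst ereal_divide_le_pos) auto
  qed
  have "upper_box_dim K \<le> Limsup (at_right 0) (\<lambda>\<epsilon>. ereal (g \<epsilon>))"
    unfolding upper_box_dim_def
    by (rule Limsup_mono) (use bound assms in \<open>auto simp: eventually_at_right_field intro!: exI[of _ "min 1 r"]\<close>)
  also have "(g \<longlongrightarrow> - (ln M / ln \<beta>)) (at_right 0)"
    unfolding g_def by real_asymp
  then have "Limsup (at_right 0) (\<lambda>\<epsilon>. ereal (g \<epsilon>)) = ereal (- (ln M / ln \<beta>))"
    by (intro lim_imp_Limsup) auto
  finally show ?thesis
    by simp
qed

theorem lemma1p1:
  fixes f :: "'a::banach \<Rightarrow> 'a"
    and f' :: "'a \<Rightarrow> 'a \<Rightarrow>\<^sub>L 'a"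
    and K U :: "'a set"
    and \<alpha> M :: real
  assumes "compact K"
    and "open U" and "K \<subseteq> U"
    and "\<And>x. x \<in> U \<Longrightarrow> (f has_derivative blinfun_apply (f' x)) (at x)"
    and "continuous_on U f'"
    and "K \<subseteq> f ` K"
    and "0 < \<alpha>" and "\<alpha> < 1" and "1 \<le> M"
    and "\<And>x. x \<in> K \<Longrightarrow>
           ereal_of_enat (covering_number (blinfun_apply (f' x) ` ball 0 1) \<alpha>) \<le> ereal M"
  shows "upper_box_dim K \<le> ereal (ln M / (- ln \<alpha>))"
proof -
  have dim: "upper_box_dim K \<le> ereal (ln M / (- ln \<beta>))" if \<beta>: "\<alpha> < \<beta>" "\<beta> < 1" for \<beta>
  proof -
    define \<eta> where "\<eta> = \<beta> - \<alpha>"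
    have \<eta>: "0 < \<eta>"
      using \<beta> by (simp add: \<eta>_def)
    obtain \<delta> where d: "0 < \<delta>"
      "\<And>x y z. \<lbrakk>x \<in> K; y \<in> ball x \<delta>; z \<in> ball x \<delta>\<rbrakk> \<Longrightarrow>
         norm (f y - f z - f' x (y - z)) \<le> \<eta> * norm (y - z)"
      using compact_uniform_linear_approx[OF assms(1,2,3,5) \<eta> assms(4)] by blast
    \<comment> \<open>If a ball of radius \<open>s \<le> r\<close> contains \<open>x\<close>, its
      centre and all its points are within \<open>2 * s \<le> \<delta>\<close> of
      \<open>x\<close>.\<close>
    define r where "r = \<delta> / 2"
    have r: "0 < r"
      using d(1) by (simp add: r_def)
    \<comment> \<open>The bound \<open>M\<close> is the same at every scale
      \<open>s \<le> r\<close>, so it can be iterated along \<open>\<beta> ^ n * r\<close>.\<close>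
    have step: "ereal_of_enat (covering_number (f ` ball c s) (\<beta> * s)) \<le> ereal M"
      if s: "0 < s" "s \<le> r" and x: "x \<in> K" "x \<in> ball c s" for s c x
    proof -
      have "norm (f y - f c - f' x (y - c)) \<le> \<eta> * s" if y: "y \<in> ball c s" for y
      proof -
        have "dist x y \<le> dist c x + dist c y"
          by (metis dist_commute dist_triangle)
        then have "y \<in> ball x \<delta>" "c \<in> ball x \<delta>"
          using x y s by (auto simp: r_def dist_commute)
        then have "norm (f y - f c - f' x (y - c)) \<le> \<eta> * norm (y - c)"
          using d(2)[OF x(1)] by blast
        also have "\<dots> \<le> \<eta> * s"
          using y \<eta> by (simp add: dist_norm norm_minus_commute)
        finally show ?thesis .
      qed
      from covering_number_image_ball[OF s(1) this assms(10)[OF x(1)]] show ?thesis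
        by (simp add: \<eta>_def)
    qed
    obtain B where B: "1 \<le> B" "ereal_of_enat (covering_number K r) \<le> ereal B"
      using compact_imp_covering_number_finite[OF assms(1) r] by blast
    have "ereal_of_enat (covering_number K (\<beta> ^ n * r)) \<le> ereal (M ^ n * B)" for n
    proof (induction n)
      case (Suc n)
      have "0 < \<beta> ^ n * r" "\<beta> ^ n * r \<le> r"
        using \<beta> assms(7) r by (auto simp: power_le_one)
      from covering_number_step[OF assms(6) _ step[OF this] Suc.IH] show ?case
        using assms(9) by (simp add: mult.assoc)
    qed (use B in simp)
    with \<beta> assms(7,9) r B(1) show ?thesis
      by (intro upper_box_dim_le[of \<beta> M r B]) auto
  qed
  \<comment> \<open>The bound is continuous at \<alpha> because \<open>ln \<alpha>\<close> is
    nonzero; hence the slack \<eta> can be sent to 0.\<close>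
  have "((\<lambda>\<beta>. ln M / (- ln \<beta>)) \<longlongrightarrow> ln M / (- ln \<alpha>)) (at_right \<alpha>)"
    using assms(7,8) by (intro tendsto_intros) auto
  then have "((\<lambda>\<beta>. ereal (ln M / (- ln \<beta>))) \<longlongrightarrow> ereal (ln M / (- ln \<alpha>))) (at_right \<alpha>)"
    by simp
  moreover have "\<forall>\<^sub>F \<beta> in at_right \<alpha>. upper_box_dim K \<le> ereal (ln M / (- ln \<beta>))"
    using dim assms(8) by (auto simp: eventually_at_right_field)
  ultimately show ?thesis
    by (rule tendsto_lowerbound) simp
qed

end
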